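(* Let $H\in\mathbb{R}^{m\times n}$ and $\hat A,\check A\in\mathbb{R}^{n\times n}$, let $h_i^T$ denote the $i$-th row of $H$, and let $$\mathcal{S}:=\{x\in\mathbb{R}^n\mid HA^kx\le 1,\ \ k=0,1,2,\dots,\ \ \forall A\in\mathrm{conv}(\hat A,\check A)\}.$$ Let $A(t):=\frac{1+t}{2}\hat A+\frac{1-t}{2}\check A$. If $\mathcal{E}_d=\{x\in\mathbb{R}^n\mid x^TP(t)x\le 1\ \ \forall t\in[-1,1]\}$ is a generalized ellipsoid of degree $d$ defined by a polynomial matrix $P(t)$ of degree $d$ which satisfies the constraints $$P(t)-A(t)^TP(t)A(t)\succeq 0\quad\forall t\in[-1,1],$$ $$P(t)\succeq h_ih_i^T\quad\forall t\in[-1,1],\quad i=1,\dots,m,$$ then $\mathcal{E}_d\subseteq\mathcal{S}$.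
   Context: The inequality $HA^kx\le 1$ is entrywise (each entry of the vector is at most $1$), and $\mathrm{conv}(\hat A,\check A)$ is the convex hull (line segment) of $\hat A$ and $\check A$. For symmetric matrices, $M\succeq N$ means $M-N$ is positive semidefinite. The set $\{x\in\mathbb{R}^n\mid x^TP(t)x\le 1\ \ \forall t\in[-1,1]\}$ is a generalized ellipsoid of degree $d$ (centered at the origin) defined by $P(t)$ when $P(t)$ is a univariate polynomial matrix (real symmetric $n\times n$ with entries polynomial in $t$) of degree at most $d$ that satisfies $P(t)\succeq 0$ for all $t\in[-1,1]$ and $\bigcap_{t\in[-1,1]}\mathrm{Ker}(P(t))=\{0\}$. *)

theory Defs
  imports "HOL-Analysis.Analysis" "HOL-Computational_Algebra.Polynomial"
begin

text \<open>The library's \<open>^\<close> on type \<^typ>\<open>real^'n^'n\<close> is the entrywise power,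
  hence a separate power with respect to the matrix product.\<close>

primrec mat_power :: "real^'n^'n \<Rightarrow> nat \<Rightarrow> real^'n^'n" where
  "mat_power A 0 = mat 1"
| "mat_power A (Suc k) = A ** mat_power A k"

definition psd :: "real^'n^'n \<Rightarrow> bool" where
  "psd M \<longleftrightarrow> transpose M = M \<and> (\<forall>x. 0 \<le> x \<bullet> (M *v x))"

definition loewner_ge :: "real^'n^'n \<Rightarrow> real^'n^'n \<Rightarrow> bool" (infix \<open>\<succeq>\<close> 50) where
  "M \<succeq> N \<longleftrightarrow> psd (M - N)"

definition mat_ker :: "real^'n^'m \<Rightarrow> (real^'n) set" where
  "mat_ker M = {x. M *v x = 0}"

definition outer :: "real^'n \<Rightarrow> real^'n \<Rightarrow> real^'n^'n" where
  "outer u v = (\<chi> j k. u $ j * v $ k)"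

definition polymat_eval :: "(real poly)^'n^'m \<Rightarrow> real \<Rightarrow> real^'n^'m" where
  "polymat_eval P t = map_matrix (\<lambda>p. poly p t) P"

definition gen_ellipsoid_set :: "(real poly)^'n^'n \<Rightarrow> (real^'n) set" where
  "gen_ellipsoid_set P = {x. \<forall>t\<in>{-1..1}. x \<bullet> (polymat_eval P t *v x) \<le> 1}"

definition is_gen_ellipsoid :: "nat \<Rightarrow> (real poly)^'n^'n \<Rightarrow> (real^'n) set \<Rightarrow> bool" where
  "is_gen_ellipsoid d P E \<longleftrightarrow>
     transpose P = P \<and>
     (\<forall>i j. degree (P $ i $ j) \<le> d) \<and>
     (\<forall>t\<in>{-1..1}. polymat_eval P t \<succeq> 0) \<and>
     (\<Inter>t\<in>{-1..1}. mat_ker (polymat_eval P t)) = {0} \<and>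
     E = gen_ellipsoid_set P"

definition safe_set :: "real^'n^'m \<Rightarrow> real^'n^'n \<Rightarrow> real^'n^'n \<Rightarrow> (real^'n) set" where
  "safe_set H Ahat Acheck =
     {x. \<forall>k. \<forall>A \<in> convex hull {Ahat, Acheck}.
           \<forall>i. (H *v (mat_power A k *v x)) $ i \<le> 1}"

definition A_interp :: "real^'n^'n \<Rightarrow> real^'n^'n \<Rightarrow> real \<Rightarrow> real^'n^'n" where
  "A_interp Ahat Acheck t = ((1 + t) / 2) *\<^sub>R Ahat + ((1 - t) / 2) *\<^sub>R Acheck"

end

theory Submission
  imports Defs
begin

text \<open>Fix a matrix \<open>A = A(t)\<close> on the segment between the two given matrices, and the value
  \<open>M = P(t)\<close> at the same parameter. The first constraint is a discrete Lyapunov inequality: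
  the quadratic form \<open>V(x) = x \<bullet> Mx\<close> satisfies \<open>V(Ax) \<le> V(x)\<close>, so
  \<open>V\<close> does not increase along the orbit \<open>x, Ax, A\<^sup>2x, \<dots>\<close> (lemma
  \<open>quadratic_form_mat_power_le\<close>). A point \<open>x\<close> of the generalized ellipsoid has
  \<open>V(x) \<le> 1\<close>, hence \<open>V(A\<^sup>k x) \<le> 1\<close> for all \<open>k\<close>. The second
  constraint says that \<open>V(y)\<close> dominates the square of every entry of \<open>Hy\<close> (lemmas
  \<open>loewner_ge_quadratic_form\<close> and \<open>quadratic_form_outer\<close>), so each entry of
  \<open>H A\<^sup>k x\<close> is at most 1.\<close>

lemma loewner_ge_quadratic_form:
  assumes "M \<succeq> N"
  shows "x \<bullet> (N *v x) \<le> x \<bullet> (M *v x)"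
proof -
  have "0 \<le> x \<bullet> ((M - N) *v x)"
    using assms by (simp add: loewner_ge_def psd_def)
  then show ?thesis
    by (simp add: matrix_vector_mult_diff_rdistrib inner_diff_right)
qed

lemma quadratic_form_outer: "x \<bullet> (outer h h *v x) = (h \<bullet> x)\<^sup>2"
proof -
  have "outer h h *v x = (h \<bullet> x) *\<^sub>R h"
    by (simp add: vec_eq_iff outer_def matrix_vector_mult_def inner_vec_def
        sum_distrib_right sum_distrib_left ac_simps)
  then show ?thesis
    by (simp add: power2_eq_square inner_commute)
qed

lemma quadratic_form_congruence:
  fixes A M :: "real^'n^'n"
  shows "x \<bullet> ((transpose A ** M ** A) *v x) = (A *v x) \<bullet> (M *v (A *v x))"
proof -
  have "(transpose A ** M ** A) *v x = transpose A *v (M *v (A *v x))"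
    by (simp add: matrix_vector_mul_assoc matrix_mul_assoc)
  moreover have "x \<bullet> (transpose A *v w) = (A *v x) \<bullet> w" for w
    using dot_lmul_matrix[of w A x] by (simp add: transpose_matrix_vector inner_commute)
  ultimately show ?thesis by simp
qed

text \<open>The Lyapunov inequality says that one application of \<open>A\<close> does not increase the
  quadratic form of \<open>M\<close>; iterating it gives the bound along the whole orbit.\<close>

lemma quadratic_form_mat_power_le:
  assumes "M - transpose A ** M ** A \<succeq> 0"
  shows "(mat_power A k *v x) \<bullet> (M *v (mat_power A k *v x)) \<le> x \<bullet> (M *v x)"
proof (induction k)
  case 0
  then show ?case by simp
next
  case (Suc k)
  define y where "y = mat_power A k *v x"
  have "M \<succeq> transpose A ** M ** A"
    using assms by (simp add: loewner_ge_def)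
  then have "(A *v y) \<bullet> (M *v (A *v y)) \<le> y \<bullet> (M *v y)"
    using loewner_ge_quadratic_form[of M "transpose A ** M ** A" y]
    by (simp only: quadratic_form_congruence)
  moreover have "mat_power A (Suc k) *v x = A *v y"
    by (simp add: y_def matrix_vector_mul_assoc)
  ultimately show ?case
    using Suc.IH by (simp add: y_def)
qed

lemma mem_convex_hull_A_interpE:
  assumes "A \<in> convex hull {Ahat, Acheck}"
  obtains t where "t \<in> {-1..1}" "A = A_interp Ahat Acheck t"
proof -
  obtain u v where uv: "0 \<le> u" "0 \<le> v" "u + v = 1" "A = u *\<^sub>R Ahat + v *\<^sub>R Acheck"
    using assms by (auto simp: convex_hull_2)
  \<comment> \<open>The parameter \<open>t\<close> solves \<open>(1 + t)/2 = u\<close> and \<open>(1 - t)/2 = v\<close>.\<close>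
  have "(1 + (u - v)) / 2 = u" "(1 - (u - v)) / 2 = v"
    using uv(3) by (simp_all add: field_simps)
  then have "A = A_interp Ahat Acheck (u - v)"
    using uv(4) by (simp only: A_interp_def)
  moreover have "u - v \<in> {-1..1}"
    using uv by auto
  ultimately show thesis using that by blast
qed

theorem theorem6p4:
  fixes H :: "real^'n^'m" and Ahat Acheck :: "real^'n^'n"
    and P :: "(real poly)^'n^'n" and d :: nat and E :: "(real^'n) set"
  assumes "is_gen_ellipsoid d P E"
    and "\<forall>t\<in>{-1..1}. polymat_eval P t
           - transpose (A_interp Ahat Acheck t) ** polymat_eval P t ** A_interp Ahat Acheck t \<succeq> 0"
    and "\<forall>t\<in>{-1..1}. \<forall>i. polymat_eval P t \<succeq> outer (row i H) (row i H)"
  shows "E \<subseteq> safe_set H Ahat Acheck"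
proof
  fix x assume "x \<in> E"
  then have x: "x \<bullet> (polymat_eval P t *v x) \<le> 1" if "t \<in> {-1..1}" for t
    using assms(1) that by (simp add: is_gen_ellipsoid_def gen_ellipsoid_set_def)
  have "(H *v (mat_power A k *v x)) $ i \<le> 1" if "A \<in> convex hull {Ahat, Acheck}" for k A i
  proof -
    obtain t where t: "t \<in> {-1..1}" and A: "A = A_interp Ahat Acheck t"
      using mem_convex_hull_A_interpE[OF \<open>A \<in> convex hull {Ahat, Acheck}\<close>] by blast
    define y where "y = mat_power A k *v x"
    define M where "M = polymat_eval P t"
    have "M - transpose A ** M ** A \<succeq> 0"
      using assms(2) t by (simp add: A M_def)
    then have "y \<bullet> (M *v y) \<le> x \<bullet> (M *v x)"
      unfolding y_def by (rule quadratic_form_mat_power_le)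
    also have "\<dots> \<le> 1"
      using x[OF t] by (simp add: M_def)
    finally have "y \<bullet> (M *v y) \<le> 1" .
    moreover have "(row i H \<bullet> y)\<^sup>2 \<le> y \<bullet> (M *v y)"
      using assms(3) t loewner_ge_quadratic_form[of M "outer (row i H) (row i H)" y]
      by (simp add: M_def quadratic_form_outer)
    ultimately have "(row i H \<bullet> y)\<^sup>2 \<le> 1\<^sup>2"
      by simp
    then have "row i H \<bullet> y \<le> 1"
      by (rule power2_le_imp_le) simp
    moreover have "(H *v y) $ i = row i H \<bullet> y"
      by (simp add: matrix_vector_mul_component row_def vec_lambda_eta)
    ultimately show ?thesis
      by (simp add: y_def)
  qed
  then show "x \<in> safe_set H Ahat Acheck"
    by (simp add: safe_set_def)
qed

end
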